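(* Let $\mathbb{R}_{+}^{\star}$ be the multiplicative group of positive real numbers and let $\mathbb{R}_{-}^{\star}=\{x\in\mathbb{R}: x<0\}$ be the group with law $x\cdot y=-xy$ (where $xy$ is the ordinary product of real numbers). Then the direct product group $\mathbb{R}_{+}^{\star}\times\mathbb{R}_{-}^{\star}$ is topologically and algebraically isomorphic to $(\mathbb{R}^{2},+)$.
   Context: $\mathbb{R}_{+}^{\star}$ and $\mathbb{R}_{-}^{\star}$ carry the topologies induced from $\mathbb{R}$, and their direct product carries the product topology. "Topologically and algebraically isomorphic" means that there is a group isomorphism which is also a homeomorphism. *)

theory Defs
  imports "HOL-Algebra.Group" "HOL-Analysis.Analysis"
begin

definition pos_real_group :: "real monoid" where
  "pos_real_group = \<lparr>carrier = {x. 0 < x}, monoid.mult = (\<lambda>x y. x * y), one = 1\<rparr>"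

definition neg_real_group :: "real monoid" where
  "neg_real_group = \<lparr>carrier = {x. x < 0}, monoid.mult = (\<lambda>x y. - (x * y)), one = - 1\<rparr>"

definition plane_add_group :: "(real ^ 2) monoid" where
  "plane_add_group = \<lparr>carrier = UNIV, monoid.mult = (\<lambda>x y. x + y), one = 0\<rparr>"

lemma group_pos_real_group: "group pos_real_group"
proof (rule groupI)
  fix x assume "x \<in> carrier pos_real_group"
  then have "inverse x \<in> carrier pos_real_group \<and>
      inverse x \<otimes>\<^bsub>pos_real_group\<^esub> x = \<one>\<^bsub>pos_real_group\<^esub>"
    by (simp add: pos_real_group_def)
  then show "\<exists>y\<in>carrier pos_real_group. y \<otimes>\<^bsub>pos_real_group\<^esub> x = \<one>\<^bsub>pos_real_group\<^esub>"
    by blast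
qed (simp_all add: pos_real_group_def)

lemma group_neg_real_group: "group neg_real_group"
proof (rule groupI)
  fix x assume "x \<in> carrier neg_real_group"
  then have "inverse x \<in> carrier neg_real_group \<and>
      inverse x \<otimes>\<^bsub>neg_real_group\<^esub> x = \<one>\<^bsub>neg_real_group\<^esub>"
    by (simp add: neg_real_group_def)
  then show "\<exists>y\<in>carrier neg_real_group. y \<otimes>\<^bsub>neg_real_group\<^esub> x = \<one>\<^bsub>neg_real_group\<^esub>"
    by blast
qed (simp_all add: neg_real_group_def mult_neg_neg)

lemma group_plane_add_group: "group plane_add_group"
proof (rule groupI)
  fix x assume "x \<in> carrier plane_add_group"
  have "- x \<in> carrier plane_add_group \<and>
      (- x) \<otimes>\<^bsub>plane_add_group\<^esub> x = \<one>\<^bsub>plane_add_group\<^esub>"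
    by (simp add: plane_add_group_def)
  then show "\<exists>y\<in>carrier plane_add_group. y \<otimes>\<^bsub>plane_add_group\<^esub> x = \<one>\<^bsub>plane_add_group\<^esub>"
    by blast
qed (simp_all add: plane_add_group_def)

text \<open>
  The topologies are separate arguments because a \<open>monoid\<close> record carries none. The definition
  is intended for groups \<open>G\<close>, \<open>H\<close> with \<open>topspace X = carrier G\<close> and \<open>topspace Y = carrier H\<close>.
\<close>

definition top_alg_isomorphic ::
    "'a monoid \<Rightarrow> 'a topology \<Rightarrow> 'b monoid \<Rightarrow> 'b topology \<Rightarrow> bool" where
  "top_alg_isomorphic G X H Y \<longleftrightarrow> (\<exists>h. h \<in> iso G H \<and> homeomorphic_map X Y h)"

end

theory Submission
  imports Defs
begin

text \<open>
  The logarithm turns multiplication of positive reals into addition, and \<open>x \<mapsto> - x\<close> carries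
  the law \<open>- (x * y)\<close> on the negative reals to ordinary multiplication on the positive ones.
  Hence \<open>(x, y) \<mapsto> (ln x, ln (- y))\<close> is a homomorphism onto the plane, with the continuous
  two-sided inverse \<open>(a, b) \<mapsto> (exp a, - exp b)\<close>; the same pair of mutually inverse maps gives both
  bijectivity and the homeomorphism property.
\<close>

definition log_coords :: "real \<times> real \<Rightarrow> real ^ 2" where
  "log_coords p = vector [ln (fst p), ln (- snd p)]"

definition exp_coords :: "real ^ 2 \<Rightarrow> real \<times> real" where
  "exp_coords v = (exp (v $ 1), - exp (v $ 2))"

lemma homeomorphic_maps_log_exp_coords:
  "homeomorphic_maps (top_of_set ({x. 0 < x} \<times> {x. x < 0})) euclidean log_coords exp_coords"
proof -
  have comps: "log_coords = (\<lambda>p. \<chi> i. if i = 1 then ln (fst p) else ln (- snd p))"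
    by (simp add: fun_eq_iff vec_eq_iff forall_2 log_coords_def)
  have "continuous_on ({x. 0 < x} \<times> {x. x < 0}) log_coords"
    unfolding comps
  proof (rule continuous_on_vec_lambda)
    fix i :: 2
    show "continuous_on ({x. 0 < x} \<times> {x. x < 0})
        (\<lambda>p::real \<times> real. if i = 1 then ln (fst p) else ln (- snd p))"
      by (cases "i = 1") (auto intro!: continuous_intros)
  qed
  moreover have "continuous_on UNIV exp_coords"
    unfolding exp_coords_def by (intro continuous_intros)
  ultimately show ?thesis
    by (auto simp: homeomorphic_maps_def continuous_map_in_subtopology
        log_coords_def exp_coords_def vec_eq_iff forall_2)
qed

lemma log_coords_hom: "log_coords \<in> hom (pos_real_group \<times>\<times> neg_real_group) plane_add_group"
proof (rule homI)
  fix p q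
  assume "p \<in> carrier (pos_real_group \<times>\<times> neg_real_group)"
    and "q \<in> carrier (pos_real_group \<times>\<times> neg_real_group)"
  then obtain a b c d where pq: "p = (a, b)" "q = (c, d)"
    and pos: "0 < a" "0 < c" and neg: "0 < - b" "0 < - d"
    by (auto simp: pos_real_group_def neg_real_group_def)
  have "ln (b * d) = ln (- b) + ln (- d)"
    using ln_mult_pos[OF neg] by simp
  with pos show "log_coords (p \<otimes>\<^bsub>pos_real_group \<times>\<times> neg_real_group\<^esub> q) =
      log_coords p \<otimes>\<^bsub>plane_add_group\<^esub> log_coords q"
    by (simp add: pq pos_real_group_def neg_real_group_def plane_add_group_def log_coords_def
        ln_mult_pos vec_eq_iff forall_2)
qed (simp add: plane_add_group_def)

theorem mainTheorem7:
  shows "top_alg_isomorphic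
    (pos_real_group \<times>\<times> neg_real_group)
    (prod_topology (top_of_set (carrier pos_real_group)) (top_of_set (carrier neg_real_group)))
    plane_add_group
    (euclidean :: (real ^ 2) topology)"
proof -
  have top: "prod_topology (top_of_set (carrier pos_real_group)) (top_of_set (carrier neg_real_group))
      = top_of_set ({x. 0 < x} \<times> {x. x < 0})"
    by (simp add: subtopology_Times[symmetric] pos_real_group_def neg_real_group_def)
  have homeo: "homeomorphic_map (top_of_set ({x. 0 < x} \<times> {x. x < 0})) euclidean log_coords"
    using homeomorphic_maps_log_exp_coords by (simp add: homeomorphic_maps_map)
  then have "bij_betw log_coords ({x. 0 < x} \<times> {x. x < 0}) UNIV"
    using homeomorphic_imp_injective_map[OF homeo] homeomorphic_imp_surjective_map[OF homeo]
    by (simp add: bij_betw_def)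
  then have "log_coords \<in> iso (pos_real_group \<times>\<times> neg_real_group) plane_add_group"
    using log_coords_hom
    by (simp add: iso_def pos_real_group_def neg_real_group_def plane_add_group_def)
  with homeo show ?thesis
    unfolding top_alg_isomorphic_def top by blast
qed

end
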